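(* Let $l\ge2$ be an integer and let $L_{rel}$ be a first-order language with relational vocabulary $\{R_1,\ldots,R_\rho\}$, $\rho>0$, where each $R_k$ has arity $r_k\ge2$. (i) For every $I\subseteq\{1,\ldots,\rho\}$ there are constants $\mu,\lambda>0$ such that, for all sufficiently large $n$, the proportion of $\mathcal{M}\in\mathbf{C}^I_n$ which have an $l$-colouring that is not $\mu n$-rich is at most $2^{-\lambda n^m}$, where $m$ is the maximum arity of the relation symbols. Consequently, the proportion of $\mathcal{M}\in\mathbf{C}^I_n$ which have only $\mu n$-rich $l$-colourings approaches $1$ as $n\to\infty$. (ii) If at least one relation symbol has arity $\le l$, then for every $I\subseteq\{1,\ldots,\rho\}$ there are constants $\mu,\lambda>0$ such that, for all sufficiently large $n$, the proportion of $\mathcal{M}\in\mathbf{S}^I_n$ which have a strong $l$-colouring that is not $\mu n$-rich is at most $2^{-\lambda n^m}$, where $m$ is the largest arity $\le l$ of a relation symbol. Consequently, the proportion of $\mathcal{M}\in\mathbf{S}^I_n$ which have only $\mu n$-rich strong $l$-colourings approaches $1$ as $n\to\infty$.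
   Context: An $l$-colouring of an $L_{rel}$-structure $\mathcal{M}$ is a function $\gamma:M\to\{1,\ldots,l\}$ such that for every $k$ and every $(a_1,\ldots,a_{r_k})\in R_k^{\mathcal{M}}$ there are $i,j$ with $\gamma(a_i)\ne\gamma(a_j)$; it is a strong $l$-colouring if for every $k$ and every $(a_1,\ldots,a_{r_k})\in R_k^{\mathcal{M}}$, $\gamma(a_i)\neq\gamma(a_j)$ whenever $i\neq j$. $\mathcal{M}$ is (strongly) $l$-colourable if it has a (strong) $l$-colouring. For $I\subseteq\{1,\ldots,\rho\}$, $\mathbf{C}^I_n$ (respectively $\mathbf{S}^I_n$) is the set of $l$-colourable (respectively strongly $l$-colourable) $L_{rel}$-structures $\mathcal{M}$ with universe $\{1,\ldots,n\}$ such that for every $k\in I$, $R_k^{\mathcal{M}}$ is irreflexive (all entries of each tuple in it are distinct) and symmetric (closed under permuting the entries of tuples). For $\alpha\in\mathbb{R}$, a function $\gamma:\{1,\ldots,n\}\to\{1,\ldots,l\}$ is $\alpha$-rich if $|\gamma^{-1}(i)|\ge\alpha$ for every $i\in\{1,\ldots,l\}$. *)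

theory Defs
  imports Complex_Main "HOL-Library.FuncSet" "HOL-Combinatorics.Combinatorics"
begin

text \<open>
  A relational vocabulary \<open>R\<^sub>1, \<dots>, R\<^sub>\<rho>\<close> is given by \<open>\<rho>\<close> and an arity function \<open>r\<close> of which
  only the values on \<open>{1..\<rho>}\<close> matter. A structure is identified with its universe \<open>U\<close> and the
  family \<open>R\<close> of its relations; tuples are lists, so their entries are numbered from \<open>0\<close>. Families
  and colourings are extensional functions, hence sets of structures have the intended
  cardinality.
\<close>

definition structures :: "nat \<Rightarrow> (nat \<Rightarrow> nat) \<Rightarrow> 'a set \<Rightarrow> (nat \<Rightarrow> 'a list set) set" where
  "structures \<rho> r U = (\<Pi>\<^sub>E k\<in>{1..\<rho>}. Pow {a. length a = r k \<and> set a \<subseteq> U})"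

definition colouring ::
  "nat \<Rightarrow> nat \<Rightarrow> 'a set \<Rightarrow> (nat \<Rightarrow> 'a list set) \<Rightarrow> ('a \<Rightarrow> nat) \<Rightarrow> bool" where
  "colouring l \<rho> U R \<gamma> \<longleftrightarrow> \<gamma> \<in> U \<rightarrow>\<^sub>E {1..l} \<and>
     (\<forall>k\<in>{1..\<rho>}. \<forall>a\<in>R k. \<exists>i<length a. \<exists>j<length a. \<gamma> (a ! i) \<noteq> \<gamma> (a ! j))"

definition strong_colouring ::
  "nat \<Rightarrow> nat \<Rightarrow> 'a set \<Rightarrow> (nat \<Rightarrow> 'a list set) \<Rightarrow> ('a \<Rightarrow> nat) \<Rightarrow> bool" where
  "strong_colouring l \<rho> U R \<gamma> \<longleftrightarrow> \<gamma> \<in> U \<rightarrow>\<^sub>E {1..l} \<and>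
     (\<forall>k\<in>{1..\<rho>}. \<forall>a\<in>R k. \<forall>i<length a. \<forall>j<length a. i \<noteq> j \<longrightarrow> \<gamma> (a ! i) \<noteq> \<gamma> (a ! j))"

definition irreflexive_rel :: "'a list set \<Rightarrow> bool" where
  "irreflexive_rel S \<longleftrightarrow> (\<forall>a\<in>S. distinct a)"

definition symmetric_rel :: "'a list set \<Rightarrow> bool" where
  "symmetric_rel S \<longleftrightarrow> (\<forall>a\<in>S. \<forall>\<pi>. \<pi> permutes {..<length a} \<longrightarrow> permute_list \<pi> a \<in> S)"

definition colourable_structures ::
  "nat \<Rightarrow> nat \<Rightarrow> (nat \<Rightarrow> nat) \<Rightarrow> nat set \<Rightarrow> nat \<Rightarrow> (nat \<Rightarrow> nat list set) set" where
  "colourable_structures l \<rho> r I n =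
     {R \<in> structures \<rho> r {1..n}. (\<exists>\<gamma>. colouring l \<rho> {1..n} R \<gamma>) \<and>
        (\<forall>k\<in>I. irreflexive_rel (R k) \<and> symmetric_rel (R k))}"

definition strongly_colourable_structures ::
  "nat \<Rightarrow> nat \<Rightarrow> (nat \<Rightarrow> nat) \<Rightarrow> nat set \<Rightarrow> nat \<Rightarrow> (nat \<Rightarrow> nat list set) set" where
  "strongly_colourable_structures l \<rho> r I n =
     {R \<in> structures \<rho> r {1..n}. (\<exists>\<gamma>. strong_colouring l \<rho> {1..n} R \<gamma>) \<and>
        (\<forall>k\<in>I. irreflexive_rel (R k) \<and> symmetric_rel (R k))}"

definition rich :: "nat \<Rightarrow> nat \<Rightarrow> real \<Rightarrow> (nat \<Rightarrow> nat) \<Rightarrow> bool" where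
  "rich l n \<alpha> \<gamma> \<longleftrightarrow> (\<forall>i\<in>{1..l}. real (card (\<gamma> -` {i} \<inter> {1..n})) \<ge> \<alpha>)"

definition proportion :: "'a set \<Rightarrow> ('a \<Rightarrow> bool) \<Rightarrow> real" where
  "proportion X P = real (card {x \<in> X. P x}) / real (card X)"

end

theory Submission
  imports Defs
begin

text \<open>
  The structures with a given colouring \<open>\<gamma>\<close> number \<open>2 ^ N \<gamma>\<close>, where \<open>N \<gamma>\<close> counts the tuples (up to
  permutation for the symmetric relations) that \<open>\<gamma>\<close> admits. If some colour class of \<open>\<gamma>\<close> has
  fewer than \<open>\<mu> n\<close> elements, moving a part of a large class into it admits at least
  \<open>c n ^ m\<close> further tuples of arity \<open>m\<close> and loses only those that meet the small class, which are at
  most \<open>m \<mu> n ^ m\<close>. The exception are strong colourings with fewer than \<open>m\<close> large classes,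
  which admit so few tuples that any balanced colouring is better. Tuples of smaller arity are negligible, so \<open>N \<gamma>\<close> lies
  of order \<open>n ^ m\<close> below the maximum of \<open>N\<close>. Since there are only \<open>l ^ n\<close> colourings and
  \<open>m \<ge> 2\<close>, the union bound gives the claim.
\<close>

section \<open>Counting the structures with a given colouring\<close>

text \<open>\<open>g\<close> is the condition that a colouring imposes on a single tuple, so one
  argument serves both kinds of colouring. \<open>b\<close> says whether the relation has to be
  irreflexive and symmetric.\<close>

definition rels ::
  "((nat \<Rightarrow> nat) \<Rightarrow> nat list \<Rightarrow> bool) \<Rightarrow> nat \<Rightarrow> nat \<Rightarrow> bool \<Rightarrow> (nat \<Rightarrow> nat) \<Rightarrow> nat list set set" where
  "rels g s n b \<gamma> = {S. S \<subseteq> {a. length a = s \<and> set a \<subseteq> {1..n} \<and> g \<gamma> a} \<and>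
     (b \<longrightarrow> irreflexive_rel S \<and> symmetric_rel S)}"

text \<open>
  A symmetric irreflexive relation is determined by its strictly increasing tuples, so the atoms
  are the tuples that may be put into a relation independently of each other.
\<close>

definition atoms ::
  "((nat \<Rightarrow> nat) \<Rightarrow> nat list \<Rightarrow> bool) \<Rightarrow> nat \<Rightarrow> nat \<Rightarrow> bool \<Rightarrow> (nat \<Rightarrow> nat) \<Rightarrow> nat list set" where
  "atoms g s n b \<gamma> = {a. length a = s \<and> set a \<subseteq> {1..n} \<and> g \<gamma> a \<and> (b \<longrightarrow> sorted_wrt (<) a)}"

definition models ::
  "((nat \<Rightarrow> nat) \<Rightarrow> nat list \<Rightarrow> bool) \<Rightarrow> nat \<Rightarrow> (nat \<Rightarrow> nat) \<Rightarrow> nat set \<Rightarrow> nat \<Rightarrow> (nat \<Rightarrow> nat) \<Rightarrow>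
     (nat \<Rightarrow> nat list set) set" where
  "models g \<rho> r I n \<gamma> = {R \<in> structures \<rho> r {1..n}. (\<forall>k\<in>{1..\<rho>}. \<forall>a\<in>R k. g \<gamma> a) \<and>
     (\<forall>k\<in>I. irreflexive_rel (R k) \<and> symmetric_rel (R k))}"

lemma finite_tuples: "finite {a :: nat list. length a = s \<and> set a \<subseteq> {1..n} \<and> P a}"
  by (rule finite_subset[OF _ finite_lists_length_eq[of "{1..n}" s]]) auto

lemma finite_atoms: "finite (atoms g s n b \<gamma>)"
  unfolding atoms_def by (rule finite_tuples)

lemma card_atoms_le: "card (atoms g s n b \<gamma>) \<le> n ^ s"
proof -
  have "card (atoms g s n b \<gamma>) \<le> card {a. set a \<subseteq> {1..n} \<and> length a = s}"
    by (rule card_mono) (auto simp: atoms_def intro: finite_lists_length_eq)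
  then show ?thesis by (simp add: card_lists_length_eq)
qed

text \<open>Lists with equal multisets differ by a permutation of positions. In this form a tuple
  can be exchanged for its sorted version.\<close>

lemma symmetric_rel_mset:
  assumes "symmetric_rel S" "a \<in> S" "mset b = mset a"
  shows "b \<in> S"
proof -
  obtain p where "p permutes {..<length a}" "permute_list p a = b"
    using mset_eq_permutation[OF assms(3)] by blast
  with assms(1,2) show ?thesis
    unfolding symmetric_rel_def by blast
qed

lemma card_rels:
  assumes inv: "\<And>a b. mset a = mset b \<Longrightarrow> g \<gamma> a = g \<gamma> b"
  shows "card (rels g s n b \<gamma>) = 2 ^ card (atoms g s n b \<gamma>)"
proof (cases b)
  case False
  then have "rels g s n b \<gamma> = Pow (atoms g s n b \<gamma>)"
    by (auto simp: rels_def atoms_def)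
  then show ?thesis by (simp add: card_Pow finite_atoms)
next
  case True
  let ?f = "\<lambda>S. S \<inter> {a. sorted_wrt (<) a}"
  let ?h = "\<lambda>Q. {a. distinct a \<and> sort a \<in> Q}"
  have sort_sorted: "sort a = a" if "sorted_wrt (<) a" for a :: "nat list"
    using that by (simp add: strict_sorted_iff sorted_sort_id)
  have "bij_betw ?f (rels g s n b \<gamma>) (Pow (atoms g s n b \<gamma>))"
  proof (rule bij_betw_byWitness[where f' = ?h])
    show "\<forall>S\<in>rels g s n b \<gamma>. ?h (?f S) = S"
    proof
      fix S assume S: "S \<in> rels g s n b \<gamma>"
      then have irr: "irreflexive_rel S" and sym: "symmetric_rel S"
        using True by (auto simp: rels_def)
      show "?h (?f S) = S"
        using irr symmetric_rel_mset[OF sym] 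
        by (auto simp: irreflexive_rel_def strict_sorted_iff)
    qed
    show "\<forall>Q\<in>Pow (atoms g s n b \<gamma>). ?f (?h Q) = Q"
      using True by (auto simp: atoms_def sort_sorted strict_sorted_iff sorted_sort_id)
    show "?f ` rels g s n b \<gamma> \<subseteq> Pow (atoms g s n b \<gamma>)"
      by (auto simp: rels_def atoms_def)
    show "?h ` Pow (atoms g s n b \<gamma>) \<subseteq> rels g s n b \<gamma>"
    proof (rule image_subsetI)
      fix Q assume Q: "Q \<in> Pow (atoms g s n b \<gamma>)"
      have "length a = s \<and> set a \<subseteq> {1..n} \<and> g \<gamma> a" if "sort a \<in> Q" for a
      proof -
        have "sort a \<in> atoms g s n b \<gamma>" using Q that by auto
        then have "length (sort a) = s" "set (sort a) \<subseteq> {1..n}" "g \<gamma> (sort a)"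
          unfolding atoms_def by blast+
        then show ?thesis using inv[of "sort a" a] by simp
      qed
      moreover have "symmetric_rel (?h Q)"
        unfolding symmetric_rel_def
      proof safe
        fix a :: "nat list" and \<pi>
        assume a: "distinct a" "sort a \<in> Q" and \<pi>: "\<pi> permutes {..<length a}"
        then show "distinct (permute_list \<pi> a)" by simp
        have "sort (permute_list \<pi> a) = sort a"
          by (rule properties_for_sort) (use \<pi> in auto)
        then show "sort (permute_list \<pi> a) \<in> Q" using a by simp
      qed
      ultimately show "?h Q \<in> rels g s n b \<gamma>"
        by (auto simp: rels_def irreflexive_rel_def)
    qed
  qed
  then have "card (rels g s n b \<gamma>) = card (Pow (atoms g s n b \<gamma>))"
    by (rule bij_betw_same_card)
  then show ?thesis by (simp add: card_Pow finite_atoms)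
qed

text \<open>The relations are chosen independently, so the structures form a product and the
  exponents add up.\<close>

lemma card_models:
  assumes inv: "\<And>a b. mset a = mset b \<Longrightarrow> g \<gamma> a = g \<gamma> b" and I: "I \<subseteq> {1..\<rho>}"
  shows "card (models g \<rho> r I n \<gamma>) = 2 ^ (\<Sum>k\<in>{1..\<rho>}. card (atoms g (r k) n (k \<in> I) \<gamma>))"
proof -
  have "models g \<rho> r I n \<gamma> = (\<Pi>\<^sub>E k\<in>{1..\<rho>}. rels g (r k) n (k \<in> I) \<gamma>)"
  proof (rule set_eqI)
    fix R
    have "R \<in> models g \<rho> r I n \<gamma> \<longleftrightarrow> R \<in> extensional {1..\<rho>} \<and>
      (\<forall>k\<in>{1..\<rho>}. R k \<subseteq> {a. length a = r k \<and> set a \<subseteq> {1..n}} \<and> (\<forall>a\<in>R k. g \<gamma> a) \<and>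
        (k \<in> I \<longrightarrow> irreflexive_rel (R k) \<and> symmetric_rel (R k)))"
      using I unfolding models_def structures_def PiE_iff by blast
    also have "\<dots> \<longleftrightarrow> R \<in> (\<Pi>\<^sub>E k\<in>{1..\<rho>}. rels g (r k) n (k \<in> I) \<gamma>)"
      unfolding PiE_iff rels_def by blast
    finally show "R \<in> models g \<rho> r I n \<gamma> \<longleftrightarrow> R \<in> (\<Pi>\<^sub>E k\<in>{1..\<rho>}. rels g (r k) n (k \<in> I) \<gamma>)" .
  qed
  then show ?thesis
    by (simp add: card_PiE card_rels[of g, OF inv] power_sum)
qed

section \<open>The union bound\<close>

lemma finite_structures: "finite (structures \<rho> r {1..n::nat})"
proof -
  have "finite {a. length a = s \<and> set a \<subseteq> {1..n}}" for s
    using finite_tuples[of s n "\<lambda>_. True"] by simp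
  then show ?thesis
    unfolding structures_def by (intro finite_PiE) auto
qed

text \<open>Nonemptiness matters: division by zero gives 0, so on the empty set both proportions
  would be 0.\<close>

lemma proportion_not:
  assumes "finite X" "X \<noteq> {}"
  shows "proportion X (\<lambda>x. \<not> P x) = 1 - proportion X P"
proof -
  have "card X = card {x \<in> X. P x} + card {x \<in> X. \<not> P x}"
    using assms(1) by (subst card_Un_disjoint[symmetric]) (auto intro: arg_cong[where f = card])
  moreover have "card X > 0" using assms by (simp add: card_gt_0_iff)
  ultimately have "real (card X) = real (card {x \<in> X. P x}) + real (card {x \<in> X. \<not> P x})"
    "real (card X) \<noteq> 0" by linarith+
  then show ?thesis
    unfolding proportion_def by (metis add_diff_cancel_left' diff_divide_distrib divide_self_if)
qed

lemma eventually_nat_ge: "\<forall>\<^sub>F n in sequentially. real n \<ge> C"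
  using filterlim_real_sequentially by (simp add: filterlim_at_top)

text \<open>Once \<open>n\<close> reaches \<open>C / c\<close>, one further factor \<open>n\<close>
  outweighs the constants. This absorbs the tuples of smaller arity and the number of
  colourings.\<close>

lemma eventually_power_bound:
  assumes "c > 0" "(m::nat) > 0"
  shows "\<forall>\<^sub>F n in sequentially. C * real n ^ (m - 1) \<le> c * real n ^ m"
  using eventually_nat_ge[of "C / c"]
proof eventually_elim
  case (elim n)
  then have "C \<le> c * real n" using assms(1) by (simp add: field_simps)
  then have "C * real n ^ (m - 1) \<le> (c * real n) * real n ^ (m - 1)"
    by (intro mult_right_mono) auto
  also have "\<dots> = c * real n ^ m"
    using assms(2) by (cases m) auto
  finally show ?case .
qed

text \<open>With \<open>M\<close> the largest number of atoms, a colouring satisfying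
  \<open>B\<close> has at most \<open>2 powr (M - c)\<close> structures, and there are at most
  \<open>l ^ n\<close> such colourings. A single colouring attaining \<open>M\<close> already puts
  \<open>2 ^ M\<close> structures into \<open>X\<close>.\<close>

lemma union_bound_proportion:
  fixes g :: "(nat \<Rightarrow> nat) \<Rightarrow> nat list \<Rightarrow> bool"
  assumes inv: "\<And>\<gamma> a b. mset a = mset b \<Longrightarrow> g \<gamma> a = g \<gamma> b" and I: "I \<subseteq> {1..\<rho>}"
    and l: "l \<ge> 1" and c: "c \<ge> 0"
    and gain: "\<And>\<gamma>. \<gamma> \<in> {1..n} \<rightarrow>\<^sub>E {1..l} \<Longrightarrow> B \<gamma> \<Longrightarrow> \<exists>\<gamma>'\<in>{1..n} \<rightarrow>\<^sub>E {1..l}.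
      real (\<Sum>k\<in>{1..\<rho>}. card (atoms g (r k) n (k \<in> I) \<gamma>)) + c
        \<le> real (\<Sum>k\<in>{1..\<rho>}. card (atoms g (r k) n (k \<in> I) \<gamma>'))"
  defines "X \<equiv> (\<Union>\<gamma>\<in>{1..n} \<rightarrow>\<^sub>E {1..l}. models g \<rho> r I n \<gamma>)"
  shows "proportion X (\<lambda>R. \<exists>\<gamma>\<in>{1..n} \<rightarrow>\<^sub>E {1..l}. R \<in> models g \<rho> r I n \<gamma> \<and> B \<gamma>)
      \<le> real l ^ n * 2 powr (- c)"
    and "finite X" "X \<noteq> {}"
proof -
  let ?\<Gamma> = "{1..n} \<rightarrow>\<^sub>E {1..l}"
  let ?N = "\<lambda>\<gamma>. \<Sum>k\<in>{1..\<rho>}. card (atoms g (r k) n (k \<in> I) \<gamma>)"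
  let ?Y = "{R \<in> X. \<exists>\<gamma>\<in>?\<Gamma>. R \<in> models g \<rho> r I n \<gamma> \<and> B \<gamma>}"
  have fin\<Gamma>: "finite ?\<Gamma>" by (simp add: finite_PiE)
  have ne: "?\<Gamma> \<noteq> {}" using l by (simp add: PiE_eq_empty_iff)
  have fin: "finite (models g \<rho> r I n \<gamma>)" for \<gamma>
    unfolding models_def using finite_structures by simp
  show finX: "finite X" unfolding X_def using fin fin\<Gamma> by blast
  define M where "M = Max (?N ` ?\<Gamma>)"
  have M_ge: "?N \<gamma> \<le> M" if "\<gamma> \<in> ?\<Gamma>" for \<gamma>
    unfolding M_def using that fin\<Gamma> by (intro Max_ge) auto
  have "M \<in> ?N ` ?\<Gamma>" unfolding M_def using fin\<Gamma> ne by (intro Max_in) auto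
  then obtain \<gamma>0 where \<gamma>0: "\<gamma>0 \<in> ?\<Gamma>" "M = ?N \<gamma>0" by blast
  have "2 ^ M = card (models g \<rho> r I n \<gamma>0)"
    unfolding \<gamma>0(2) by (rule card_models[of g, OF inv I, symmetric])
  also have "\<dots> \<le> card X"
    using \<gamma>0(1) finX by (intro card_mono) (auto simp: X_def)
  finally have X_ge: "2 ^ M \<le> card X" .
  then have X_pos: "card X > 0"
    by (metis gr0I le_zero_eq power_not_zero zero_neq_numeral)
  then show "X \<noteq> {}" by auto
  have "?Y \<subseteq> (\<Union>\<gamma>\<in>{\<gamma>\<in>?\<Gamma>. B \<gamma>}. models g \<rho> r I n \<gamma>)" by auto
  then have "card ?Y \<le> card (\<Union>\<gamma>\<in>{\<gamma>\<in>?\<Gamma>. B \<gamma>}. models g \<rho> r I n \<gamma>)"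
    using fin fin\<Gamma> by (intro card_mono) auto
  also have "\<dots> \<le> (\<Sum>\<gamma>\<in>{\<gamma>\<in>?\<Gamma>. B \<gamma>}. card (models g \<rho> r I n \<gamma>))"
    using fin\<Gamma> by (intro card_UN_le) auto
  finally have "real (card ?Y) \<le> (\<Sum>\<gamma>\<in>{\<gamma>\<in>?\<Gamma>. B \<gamma>}. real (card (models g \<rho> r I n \<gamma>)))"
    by (simp only: of_nat_sum[symmetric] of_nat_le_iff)
  also have "\<dots> \<le> (\<Sum>\<gamma>\<in>{\<gamma>\<in>?\<Gamma>. B \<gamma>}. 2 powr (real M - c))"
  proof (rule sum_mono)
    fix \<gamma> assume "\<gamma> \<in> {\<gamma>\<in>?\<Gamma>. B \<gamma>}"
    then obtain \<gamma>' where "\<gamma>' \<in> ?\<Gamma>" "real (?N \<gamma>) + c \<le> real (?N \<gamma>')"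
      using gain by blast
    with M_ge[of \<gamma>'] have "real (?N \<gamma>) \<le> real M - c" by linarith
    then have "2 powr real (?N \<gamma>) \<le> 2 powr (real M - c)" by (intro powr_mono) auto
    then show "real (card (models g \<rho> r I n \<gamma>)) \<le> 2 powr (real M - c)"
      by (simp only: card_models[of g, OF inv I] of_nat_power of_nat_numeral powr_realpow[of 2, symmetric])
  qed
  also have "\<dots> = real (card {\<gamma>\<in>?\<Gamma>. B \<gamma>}) * 2 powr (real M - c)" by simp
  also have "\<dots> \<le> real l ^ n * 2 powr (real M - c)"
  proof (rule mult_right_mono)
    have "card {\<gamma>\<in>?\<Gamma>. B \<gamma>} \<le> card ?\<Gamma>" using fin\<Gamma> by (intro card_mono) auto
    also have "\<dots> = l ^ n" by (simp add: card_PiE)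
    finally show "real (card {\<gamma>\<in>?\<Gamma>. B \<gamma>}) \<le> real l ^ n"
      by (simp only: of_nat_power[symmetric] of_nat_le_iff)
  qed simp
  also have "\<dots> = (real l ^ n * 2 powr (- c)) * 2 ^ M"
    by (simp only: diff_conv_add_uminus powr_add powr_realpow[of 2] mult_ac zero_less_numeral)
  also have "\<dots> \<le> (real l ^ n * 2 powr (- c)) * real (card X)"
  proof (rule mult_left_mono)
    show "2 ^ M \<le> real (card X)" using X_ge by (metis of_nat_le_iff of_nat_numeral of_nat_power)
  qed simp
  finally show "proportion X (\<lambda>R. \<exists>\<gamma>\<in>?\<Gamma>. R \<in> models g \<rho> r I n \<gamma> \<and> B \<gamma>)
      \<le> real l ^ n * 2 powr (- c)"
    unfolding proportion_def using X_pos by (subst pos_divide_le_eq) auto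
qed

section \<open>Recolouring\<close>

text \<open>A tuple meeting \<open>C\<close> is given by a position \<open>p\<close>, an entry from
  \<open>C\<close> at that position and the remaining \<open>m - 1\<close> entries. Tuples with
  several entries in \<open>C\<close> arise repeatedly, which is harmless for an upper
  bound.\<close>

lemma card_lists_meeting_le:
  fixes C :: "nat set"
  assumes "finite C"
  shows "card {a. length a = m \<and> set a \<subseteq> {1..n} \<and> set a \<inter> C \<noteq> {}} \<le> m * card C * n ^ (m - 1)"
    (is "card ?T \<le> _")
proof -
  let ?L = "{b. set b \<subseteq> {1..n} \<and> length b = m - 1}"
  let ?ins = "\<lambda>p (x, b). take p b @ x # drop p b"
  have finL: "finite ?L" by (rule finite_lists_length_eq) simp
  have "?T \<subseteq> (\<Union>p\<in>{..<m}. ?ins p ` (C \<times> ?L))"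
  proof
    fix a assume a: "a \<in> ?T"
    then obtain p where p: "p < length a" "a ! p \<in> C" by (auto simp: set_conv_nth)
    have "a = ?ins p (a ! p, take p a @ drop (Suc p) a)"
      using p by (simp add: id_take_nth_drop[symmetric] min_def)
    moreover have "take p a @ drop (Suc p) a \<in> ?L"
      using a p set_take_subset[of p a] set_drop_subset[of "Suc p" a] by auto
    ultimately have "a \<in> ?ins p ` (C \<times> ?L)" using p by blast
    then show "a \<in> (\<Union>p\<in>{..<m}. ?ins p ` (C \<times> ?L))" using a p by blast
  qed
  then have "card ?T \<le> card (\<Union>p\<in>{..<m}. ?ins p ` (C \<times> ?L))"
    using finL assms by (intro card_mono) auto
  also have "\<dots> \<le> (\<Sum>p\<in>{..<m}. card (?ins p ` (C \<times> ?L)))"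
    by (rule card_UN_le) simp
  also have "\<dots> \<le> (\<Sum>p\<in>{..<m}. card (C \<times> ?L))"
    using finL assms by (intro sum_mono card_image_le) auto
  also have "\<dots> = m * card C * n ^ (m - 1)"
    by (simp add: card_cartesian_product card_lists_length_eq)
  finally show ?thesis .
qed

section \<open>Transversals of disjoint sets\<close>

text \<open>The chosen elements are listed in increasing order, so the lists satisfy the ordering
  condition of \<open>atoms\<close> for either value of \<open>b\<close>.\<close>

definition transversals :: "nat \<Rightarrow> (nat \<Rightarrow> nat set) \<Rightarrow> nat list set" where
  "transversals m D = (\<lambda>f. sorted_list_of_set (f ` {..<m})) ` (\<Pi>\<^sub>E p\<in>{..<m}. D p)"

text \<open>Disjointness makes the choice function \<open>f\<close> injective, so the list has full
  length \<open>m\<close>. Sorting may move \<open>f p\<close> away from position \<open>p\<close>;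
  only the set of entries is tied to \<open>f\<close>.\<close>

lemma transversals_props:
  assumes disj: "disjoint_family_on D {..<m}" and a: "a \<in> transversals m D"
  obtains f where "\<And>p. p < m \<Longrightarrow> f p \<in> D p" "set a = f ` {..<m}" "inj_on f {..<m}"
    "length a = m" "sorted_wrt (<) a"
proof -
  from a obtain f where f: "f \<in> (\<Pi>\<^sub>E p\<in>{..<m}. D p)" "a = sorted_list_of_set (f ` {..<m})"
    unfolding transversals_def by blast
  have inj: "inj_on f {..<m}"
  proof (rule inj_onI)
    fix p p' assume p: "p \<in> {..<m}" "p' \<in> {..<m}" and eq: "f p = f p'"
    have "f p \<in> D p \<inter> D p'"
      using PiE_mem[OF f(1) p(1)] PiE_mem[OF f(1) p(2)] eq by simp
    then show "p = p'" using disj p by (auto simp: disjoint_family_on_def)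
  qed
  show thesis
    by (rule that[of f]) (use f inj in \<open>auto simp: card_image\<close>)
qed

text \<open>Each entry lies in exactly one of the sets \<open>D p\<close>, so the choice function
  can be recovered from the set of entries.\<close>

lemma card_transversals:
  assumes disj: "disjoint_family_on D {..<m}" and fin: "\<And>p. p < m \<Longrightarrow> finite (D p)"
    and q: "\<And>p. p < m \<Longrightarrow> q \<le> card (D p)"
  shows "finite (transversals m D)" "q ^ m \<le> card (transversals m D)"
proof -
  let ?P = "\<Pi>\<^sub>E p\<in>{..<m}. D p"
  have finP: "finite ?P" using fin by (intro finite_PiE) auto
  then show "finite (transversals m D)" by (simp add: transversals_def)
  have "inj_on (\<lambda>f. sorted_list_of_set (f ` {..<m})) ?P"
  proof (rule inj_onI)
    fix f h assume f: "f \<in> ?P" and h: "h \<in> ?P"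
      and eq: "sorted_list_of_set (f ` {..<m}) = sorted_list_of_set (h ` {..<m})"
    have img: "f ` {..<m} = h ` {..<m}"
      using arg_cong[OF eq, of set] by simp
    show "f = h"
    proof (rule PiE_ext[OF f h])
      fix p assume p: "p \<in> {..<m}"
      then obtain p' where p': "p' \<in> {..<m}" "f p = h p'" using img by blast
      have "f p \<in> D p" "h p' \<in> D p'"
        using PiE_mem[OF f p] PiE_mem[OF h p'(1)] by auto
      then have "D p \<inter> D p' \<noteq> {}" using p'(2) by auto
      then have "p = p'" using disj p p'(1) by (auto simp: disjoint_family_on_def)
      then show "f p = h p" using p' by simp
    qed
  qed
  then have "card (transversals m D) = (\<Prod>p<m. card (D p))"
    by (simp add: transversals_def card_image card_PiE)
  moreover have "(\<Prod>p<m. q) \<le> (\<Prod>p<m. card (D p))"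
    using q by (intro prod_mono) auto
  ultimately show "q ^ m \<le> card (transversals m D)" by simp
qed

text \<open>The parts are consecutive blocks of length \<open>q\<close> in an enumeration of
  \<open>S\<close>; elements beyond the first \<open>m * q\<close> are left over.\<close>

lemma split_into_equal_parts:
  assumes "finite S" "m * q \<le> card S"
  obtains D :: "nat \<Rightarrow> 'a set" where "disjoint_family_on D {..<m}" "\<And>p. p < m \<Longrightarrow> D p \<subseteq> S"
    "\<And>p. p < m \<Longrightarrow> card (D p) = q"
proof -
  obtain h where h: "bij_betw h {0..<card S} S"
    using ex_bij_betw_nat_finite[OF assms(1)] by blast
  define D where "D p = h ` {p * q..<Suc p * q}" for p
  have sub: "{p * q..<Suc p * q} \<subseteq> {0..<card S}" if "p < m" for p
  proof -
    have "Suc p * q \<le> m * q" using that by (intro mult_right_mono) auto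
    then show ?thesis using assms(2) by auto
  qed
  have inj: "inj_on h {0..<card S}" using h by (rule bij_betw_imp_inj_on)
  show thesis
  proof
    show "disjoint_family_on D {..<m}"
      unfolding disjoint_family_on_def
    proof (intro ballI impI)
      fix p p' assume p: "p \<in> {..<m}" "p' \<in> {..<m}" "p \<noteq> p'"
      have "{p * q..<Suc p * q} \<inter> {p' * q..<Suc p' * q} = {}"
      proof (cases "p < p'")
        case True
        then have "Suc p * q \<le> p' * q" by (intro mult_right_mono) auto
        then show ?thesis by auto
      next
        case False
        then have "Suc p' * q \<le> p * q" using p by (intro mult_right_mono) auto
        then show ?thesis by auto
      qed
      then show "D p \<inter> D p' = {}"
        unfolding D_def using inj_on_image_Int[OF inj sub sub, of p p'] p by auto
    qed
    show "D p \<subseteq> S" if "p < m" for p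
      using sub[OF that] h by (auto simp: D_def bij_betw_def)
    show "card (D p) = q" if "p < m" for p
      unfolding D_def using inj_on_subset[OF inj sub[OF that]] by (simp add: card_image)
  qed
qed

lemma half_floor_bound:
  assumes "\<beta> > 0" "real n \<ge> 2 / \<beta>"
  shows "real (nat \<lfloor>\<beta> * real n\<rfloor>) \<ge> \<beta> / 2 * real n" "real (nat \<lfloor>\<beta> * real n\<rfloor>) \<le> \<beta> * real n"
proof -
  \<comment> \<open>Rounding down costs less than 1, which is at most half of a number that is at
    least 2.\<close>
  have "\<beta> * real n \<ge> 2" using assms by (simp add: field_simps)
  then show "real (nat \<lfloor>\<beta> * real n\<rfloor>) \<ge> \<beta> / 2 * real n" "real (nat \<lfloor>\<beta> * real n\<rfloor>) \<le> \<beta> * real n"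
    by linarith+
qed

section \<open>Conditions on tuples and their behaviour under recolouring\<close>

definition nonconstant :: "(nat \<Rightarrow> nat) \<Rightarrow> nat list \<Rightarrow> bool" where
  "nonconstant \<gamma> a \<longleftrightarrow> (\<exists>x\<in>set a. \<exists>y\<in>set a. \<gamma> x \<noteq> \<gamma> y)"

text \<open>Distinctness of the mapped list compares positions, as \<open>strong_colouring\<close>
  does; hence the entries of a rainbow tuple are themselves distinct.\<close>

definition rainbow :: "(nat \<Rightarrow> nat) \<Rightarrow> nat list \<Rightarrow> bool" where
  "rainbow \<gamma> a \<longleftrightarrow> distinct (map \<gamma> a)"

definition recolour :: "nat set \<Rightarrow> nat \<Rightarrow> (nat \<Rightarrow> nat) \<Rightarrow> nat \<Rightarrow> nat" where
  "recolour A i \<gamma> x = (if x \<in> A then i else \<gamma> x)"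

text \<open>The transversals become atoms only through the recolouring. Every atom that is lost
  meets \<open>C\<close>, the old class of colour \<open>i\<close>, and
  \<open>card_lists_meeting_le\<close> bounds the number of such tuples.\<close>

lemma recolour_gain:
  fixes g :: "(nat \<Rightarrow> nat) \<Rightarrow> nat list \<Rightarrow> bool" and \<gamma> :: "nat \<Rightarrow> nat" and i n m q :: nat
  defines "C \<equiv> \<gamma> -` {i} \<inter> {1..n}"
  assumes lost: "\<And>a. set a \<subseteq> {1..n} \<Longrightarrow> g \<gamma> a \<Longrightarrow> \<not> g (recolour A i \<gamma>) a \<Longrightarrow> set a \<inter> C \<noteq> {}"
    and disj: "disjoint_family_on D {..<m}" and D: "\<And>p. p < m \<Longrightarrow> D p \<subseteq> {1..n}"
    and q: "\<And>p. p < m \<Longrightarrow> q \<le> card (D p)"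
    and won: "\<And>a. a \<in> transversals m D \<Longrightarrow> g (recolour A i \<gamma>) a \<and> \<not> g \<gamma> a"
  shows "card (atoms g m n b \<gamma>) + q ^ m
    \<le> card (atoms g m n b (recolour A i \<gamma>)) + m * card C * n ^ (m - 1)"
proof -
  let ?T = "{a. length a = m \<and> set a \<subseteq> {1..n} \<and> set a \<inter> C \<noteq> {}}"
  let ?A = "atoms g m n b \<gamma>" and ?A' = "atoms g m n b (recolour A i \<gamma>)"
  have finD: "finite (D p)" if "p < m" for p
    using D[OF that] finite_subset by blast
  note tr = card_transversals[OF disj finD q]
  have tr_sub: "transversals m D \<subseteq> ?A'"
  proof
    fix a assume a: "a \<in> transversals m D"
    then obtain f where "\<And>p. p < m \<Longrightarrow> f p \<in> D p" "set a = f ` {..<m}"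
      "length a = m" "sorted_wrt (<) a"
      using transversals_props[OF disj] by metis
    then show "a \<in> ?A'"
      using D won[OF a] by (fastforce simp: atoms_def)
  qed
  have "?A \<inter> transversals m D = {}" using won by (auto simp: atoms_def)
  then have "card ?A + card (transversals m D) = card (?A \<union> transversals m D)"
    by (intro card_Un_disjoint[symmetric] finite_atoms tr(1))
  also have "\<dots> \<le> card (?A' \<union> ?T)"
  proof (rule card_mono)
    show "finite (?A' \<union> ?T)" using finite_atoms finite_tuples by simp
    show "?A \<union> transversals m D \<subseteq> ?A' \<union> ?T"
      using tr_sub lost by (auto simp: atoms_def)
  qed
  also have "\<dots> \<le> card ?A' + card ?T" by (rule card_Un_le)
  also have "card ?T \<le> m * card C * n ^ (m - 1)"
    by (rule card_lists_meeting_le) (simp add: C_def)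
  finally show ?thesis using tr(2) by linarith
qed

text \<open>Two different colours other than \<open>i\<close> are never merged: \<open>A\<close>
  lies in one class, so the two vertices are not both recoloured, and if one of them is, the other
  keeps a colour different from \<open>i\<close>.\<close>

lemma nonconstant_lost:
  assumes "\<And>x. x \<in> A \<Longrightarrow> \<gamma> x = j" "nonconstant \<gamma> a" "\<not> nonconstant (recolour A i \<gamma>) a"
  shows "\<exists>x\<in>set a. \<gamma> x = i"
proof (rule ccontr)
  assume no: "\<not> ?thesis"
  obtain x y where xy: "x \<in> set a" "y \<in> set a" "\<gamma> x \<noteq> \<gamma> y"
    using assms(2) by (auto simp: nonconstant_def)
  have "recolour A i \<gamma> x = recolour A i \<gamma> y"
    using assms(3) xy(1,2) unfolding nonconstant_def by blast
  moreover have "\<gamma> x \<noteq> i" "\<gamma> y \<noteq> i" using no xy(1,2) by blast+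
  ultimately show False
    using xy(3) assms(1)[of x] assms(1)[of y] by (auto simp: recolour_def split: if_splits)
qed

text \<open>A new coincidence of colours needs an entry that already had colour \<open>i\<close>,
  since the recoloured entries all come from one class.\<close>

lemma rainbow_lost:
  assumes "\<And>x. x \<in> A \<Longrightarrow> \<gamma> x = j" "rainbow \<gamma> a" "\<not> rainbow (recolour A i \<gamma>) a"
  shows "\<exists>x\<in>set a. \<gamma> x = i"
proof (rule ccontr)
  assume no: "\<not> ?thesis"
  have "distinct a" "inj_on \<gamma> (set a)" using assms(2) by (auto simp: rainbow_def distinct_map)
  moreover from this(2) have "inj_on (recolour A i \<gamma>) (set a)"
    using no assms(1) by (auto simp: inj_on_def recolour_def split: if_splits)
  ultimately show False using assms(3) by (simp add: rainbow_def distinct_map)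
qed

lemma recolour_PiE:
  assumes "\<gamma> \<in> {1..n} \<rightarrow>\<^sub>E {1..l}" "A \<subseteq> {1..n}" "i \<in> {1..l}"
  shows "recolour A i \<gamma> \<in> {1..n} \<rightarrow>\<^sub>E {1..l}"
proof (rule PiE_I)
  show "recolour A i \<gamma> x \<in> {1..l}" if "x \<in> {1..n}" for x
    using PiE_mem[OF assms(1) that] assms(3) by (simp add: recolour_def)
  show "recolour A i \<gamma> x = undefined" if "x \<notin> {1..n}" for x
    using PiE_arb[OF assms(1) that] assms(2) that by (auto simp: recolour_def)
qed

text \<open>The bound on \<open>\<mu>\<close> keeps the loss within half of the gain, which is at
  least \<open>(\<delta> * n) ^ m\<close>. Here \<open>x\<close> and \<open>y\<close> are the
  numbers of atoms of the old and the new colouring, and \<open>c\<close> is the size of the set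
  responsible for the loss.\<close>

lemma gain_absorbs_loss:
  fixes x y c n m q :: nat and \<mu> \<delta> :: real
  assumes "x + q ^ m \<le> y + m * c * n ^ (m - 1)" "m > 0" "real c \<le> \<mu> * real n"
    "\<mu> \<le> \<delta> ^ m / (2 * real m)" "\<delta> \<ge> 0" "\<delta> * real n \<le> real q"
  shows "real x + \<delta> ^ m / 2 * real n ^ m \<le> real y"
proof -
  have "real x + real q ^ m \<le> real y + real m * real c * real n ^ (m - 1)"
    using assms(1) by (metis of_nat_add of_nat_le_iff of_nat_mult of_nat_power)
  moreover have "(\<delta> * real n) ^ m \<le> real q ^ m"
    using assms by (intro power_mono) auto
  moreover have "real m * real c * real n ^ (m - 1) \<le> \<delta> ^ m / 2 * real n ^ m"
  proof -
    have "real m * real c \<le> real m * (\<delta> ^ m / (2 * real m) * real n)"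
      by (intro mult_left_mono order_trans[OF assms(3)] mult_right_mono assms(4)) auto
    also have "\<dots> = \<delta> ^ m / 2 * real n" using assms(2) by simp
    finally have "real m * real c * real n ^ (m - 1) \<le> \<delta> ^ m / 2 * real n * real n ^ (m - 1)"
      by (intro mult_right_mono) auto
    also have "\<dots> = \<delta> ^ m / 2 * real n ^ m"
      using assms(2) by (cases m) auto
    finally show ?thesis .
  qed
  ultimately show ?thesis by (simp add: power_mult_distrib)
qed

section \<open>Improving colourings that are not rich\<close>

text \<open>The \<open>l\<close> classes cover \<open>{1..n}\<close>, so they cannot all be below
  the average size.\<close>

lemma large_colour_class:
  assumes "\<gamma> \<in> {1..n} \<rightarrow>\<^sub>E {1..l}" "l \<ge> 1"
  obtains j where "j \<in> {1..l}" "real n / real l \<le> real (card (\<gamma> -` {j} \<inter> {1..n}))"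
proof (rule ccontr)
  assume "\<not> thesis"
  then have small: "real (card (\<gamma> -` {j} \<inter> {1..n})) < real n / real l" if "j \<in> {1..l}" for j
    using that \<open>\<And>j. _ \<Longrightarrow> _ \<Longrightarrow> thesis\<close> by fastforce
  have "{1..n} \<subseteq> (\<Union>j\<in>{1..l}. \<gamma> -` {j} \<inter> {1..n})"
    using assms(1) by (auto simp: PiE_iff)
  then have "card {1..n} \<le> card (\<Union>j\<in>{1..l}. \<gamma> -` {j} \<inter> {1..n})"
    by (intro card_mono) auto
  also have "\<dots> \<le> (\<Sum>j\<in>{1..l}. card (\<gamma> -` {j} \<inter> {1..n}))"
    by (rule card_UN_le) simp
  finally have "real n \<le> real (\<Sum>j\<in>{1..l}. card (\<gamma> -` {j} \<inter> {1..n}))"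
    by (simp only: of_nat_le_iff card_atLeastAtMost diff_Suc_1 One_nat_def)
  also have "\<dots> = (\<Sum>j\<in>{1..l}. real (card (\<gamma> -` {j} \<inter> {1..n})))" by simp
  also have "\<dots> < (\<Sum>j\<in>{1..l}. real n / real l)"
    using small assms(2) by (intro sum_strict_mono) auto
  also have "\<dots> = real n" using assms(2) by simp
  finally show False by simp
qed

text \<open>One colouring has to serve both values of \<open>b\<close>, because symbols of arity
  \<open>m\<close> may lie inside and outside \<open>I\<close>.\<close>

definition improvable ::
  "((nat \<Rightarrow> nat) \<Rightarrow> nat list \<Rightarrow> bool) \<Rightarrow> nat \<Rightarrow> nat \<Rightarrow> nat \<Rightarrow> real \<Rightarrow> (nat \<Rightarrow> nat) \<Rightarrow> bool" where
  "improvable g l m n c \<gamma> \<longleftrightarrow> (\<exists>\<gamma>'\<in>{1..n} \<rightarrow>\<^sub>E {1..l}. \<forall>b.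
     real (card (atoms g m n b \<gamma>)) + c * real n ^ m \<le> real (card (atoms g m n b \<gamma>')))"

lemma improvable_mono:
  assumes "improvable g l m n c \<gamma>" "c' \<le> c"
  shows "improvable g l m n c' \<gamma>"
proof -
  have "c' * real n ^ m \<le> c * real n ^ m" using assms(2) by (intro mult_right_mono) auto
  then show ?thesis using assms(1) unfolding improvable_def by (meson add_left_mono order_trans)
qed

section \<open>Ordinary colourings\<close>

text \<open>A class \<open>j\<close> of at least average size contains \<open>m\<close> disjoint
  blocks, and the block \<open>D 0\<close> is given the colour \<open>i\<close> of a small class.
  Tuples with one entry in each block were constant and now show both \<open>i\<close> and
  \<open>j\<close>.\<close>

lemma nonconstant_improvable:
  assumes "l \<ge> 2" "m \<ge> 2"
  shows "\<exists>\<mu>>0. \<exists>c>0. \<forall>\<^sub>F n in sequentially. \<forall>\<gamma>\<in>{1..n} \<rightarrow>\<^sub>E {1..l}.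
    \<not> rich l n (\<mu> * real n) \<gamma> \<longrightarrow> improvable nonconstant l m n c \<gamma>"
proof -
  \<comment> \<open>With this value, \<open>m\<close> blocks of size at most
    \<open>\<beta> * n\<close> fit into a class of size \<open>n / l\<close>.\<close>
  define \<beta> where "\<beta> = 1 / (real l * real m)"
  define \<delta> where "\<delta> = \<beta> / 2"
  define \<mu> where "\<mu> = \<delta> ^ m / (2 * real m)"
  have \<beta>: "\<beta> > 0" using assms by (simp add: \<beta>_def)
  have \<delta>: "\<delta> > 0" "\<delta> \<le> 1 / real l" "\<delta> \<le> 1"
    using assms by (auto simp: \<delta>_def \<beta>_def field_simps mult_ge1_I)
  \<comment> \<open>The chain \<open>\<mu> \<le> \<delta> ^ m \<le> \<delta> \<le> 1 / l\<close>
    ensures below that a class with fewer than \<open>\<mu> * n\<close> elements is not the large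
    class \<open>j\<close>.\<close>
  have "\<mu> \<le> \<delta> ^ m" using \<delta>(1) assms by (simp add: \<mu>_def field_simps)
  also have "\<dots> \<le> \<delta>" using \<delta> assms power_decreasing[of 1 m \<delta>] by simp
  finally have \<mu>: "\<mu> > 0" "\<mu> \<le> 1 / real l" using \<delta> assms by (auto simp: \<mu>_def)
  have "\<forall>\<^sub>F n in sequentially. \<forall>\<gamma>\<in>{1..n} \<rightarrow>\<^sub>E {1..l}.
    \<not> rich l n (\<mu> * real n) \<gamma> \<longrightarrow> improvable nonconstant l m n (\<delta> ^ m / 2) \<gamma>"
    using eventually_nat_ge[of "2 / \<beta>"]
  proof eventually_elim
    case (elim n)
    show ?case
    proof (intro ballI impI)
      fix \<gamma> assume \<gamma>: "\<gamma> \<in> {1..n} \<rightarrow>\<^sub>E {1..l}" and "\<not> rich l n (\<mu> * real n) \<gamma>"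
      then obtain i where i: "i \<in> {1..l}" "real (card (\<gamma> -` {i} \<inter> {1..n})) < \<mu> * real n"
        by (auto simp: rich_def)
      obtain j where j: "j \<in> {1..l}" "real n / real l \<le> real (card (\<gamma> -` {j} \<inter> {1..n}))"
        using large_colour_class[OF \<gamma>] assms by auto
      define q where "q = nat \<lfloor>\<beta> * real n\<rfloor>"
      note q = half_floor_bound[OF \<beta> elim, folded q_def \<delta>_def]
      have "\<mu> * real n \<le> 1 / real l * real n" using \<mu> by (intro mult_right_mono) auto
      with i j have ij: "i \<noteq> j" by auto
      have "real m * real q \<le> real m * (\<beta> * real n)" using q(2) by (intro mult_left_mono) auto
      also have "\<dots> = real n / real l" using assms by (simp add: \<beta>_def)
      also note j(2)
      finally have "m * q \<le> card (\<gamma> -` {j} \<inter> {1..n})"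
        by (simp only: of_nat_mult[symmetric] of_nat_le_iff)
      then obtain D where D: "disjoint_family_on D {..<m}"
        "\<And>p. p < m \<Longrightarrow> D p \<subseteq> \<gamma> -` {j} \<inter> {1..n}" "\<And>p. p < m \<Longrightarrow> card (D p) = q"
        using split_into_equal_parts[of "\<gamma> -` {j} \<inter> {1..n}" m q] by auto
      let ?\<gamma>' = "recolour (D 0) i \<gamma>"
      have D0: "\<And>x. x \<in> D 0 \<Longrightarrow> \<gamma> x = j" using D(2)[of 0] assms by auto
      have lost: "set a \<inter> (\<gamma> -` {i} \<inter> {1..n}) \<noteq> {}"
        if "set a \<subseteq> {1..n}" "nonconstant \<gamma> a" "\<not> nonconstant ?\<gamma>' a" for a
        using nonconstant_lost[OF D0 that(2,3)] that(1) by auto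
      have won: "nonconstant ?\<gamma>' a \<and> \<not> nonconstant \<gamma> a" if a: "a \<in> transversals m D" for a
      proof -
        obtain f where f: "\<And>p. p < m \<Longrightarrow> f p \<in> D p" "set a = f ` {..<m}"
          using transversals_props[OF D(1) a] by metis
        have "f p \<in> set a" if "p < m" for p using f(2) that by auto
        then have f01: "f 0 \<in> set a" "f 1 \<in> set a" using assms(2) by auto
        have "D 1 \<inter> D 0 = {}" using D(1) assms(2) by (auto simp: disjoint_family_on_def)
        then have "f 1 \<notin> D 0" using f(1)[of 1] assms(2) by auto
        moreover have "\<gamma> (f 1) = j" using f(1)[of 1] D(2)[of 1] assms(2) by auto
        moreover have "f 0 \<in> D 0" using f(1)[of 0] assms(2) by auto
        ultimately have "?\<gamma>' (f 0) \<noteq> ?\<gamma>' (f 1)" using ij by (simp add: recolour_def)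
        moreover have "\<gamma> x = j" if "x \<in> set a" for x
          using that f D(2) by fastforce
        ultimately show ?thesis using f01 unfolding nonconstant_def by metis
      qed
      have "card (atoms nonconstant m n b \<gamma>) + q ^ m
        \<le> card (atoms nonconstant m n b ?\<gamma>') + m * card (\<gamma> -` {i} \<inter> {1..n}) * n ^ (m - 1)" for b
        by (rule recolour_gain[OF lost D(1) _ _ won]) (use D in auto)
      then have "real (card (atoms nonconstant m n b \<gamma>)) + \<delta> ^ m / 2 * real n ^ m
        \<le> real (card (atoms nonconstant m n b ?\<gamma>'))" for b
        by (rule gain_absorbs_loss) (use assms i(2) \<mu>_def \<delta>(1) q(1) in auto)
      moreover have "?\<gamma>' \<in> {1..n} \<rightarrow>\<^sub>E {1..l}"
        by (rule recolour_PiE[OF \<gamma> _ i(1)]) (use D(2)[of 0] assms in auto)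
      ultimately show "improvable nonconstant l m n (\<delta> ^ m / 2) \<gamma>"
        unfolding improvable_def by blast
    qed
  qed
  then show ?thesis using \<mu>(1) \<delta>(1) by (intro exI[of _ \<mu>] conjI exI[of _ "\<delta> ^ m / 2"]) simp_all
qed

section \<open>Strong colourings\<close>

text \<open>Disjoint blocks of size \<open>q\<close>, one for each of the \<open>l\<close> colours,
  are coloured differently; since \<open>m \<le> l\<close>, there are \<open>m\<close> of them, and
  tuples with one entry in each are rainbow.\<close>

lemma balanced_rainbow_atoms:
  assumes "m \<le> l" "l * q \<le> n" "l \<ge> 1"
  obtains \<gamma> where "\<gamma> \<in> {1..n} \<rightarrow>\<^sub>E {1..l}" "\<And>b. q ^ m \<le> card (atoms rainbow m n b \<gamma>)"
proof -
  obtain D where D: "disjoint_family_on D {..<l}" "\<And>p. p < l \<Longrightarrow> D p \<subseteq> {1..n}"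
    "\<And>p. p < l \<Longrightarrow> card (D p) = q"
    using split_into_equal_parts[of "{1..n}" l q] assms(2) by auto
  \<comment> \<open>Blocks are numbered from 0 and colours from 1, hence \<open>Suc\<close>.
    Vertices outside the blocks get the default colour 1, which only has to be a legal
    colour.\<close>
  define \<gamma> where "\<gamma> = (\<lambda>x\<in>{1..n}. if \<exists>p<l. x \<in> D p then Suc (THE p. p < l \<and> x \<in> D p) else 1)"
  have col: "\<gamma> x = Suc p" if "p < l" "x \<in> D p" for x p
  proof -
    have "(THE p. p < l \<and> x \<in> D p) = p"
      using that D(1) by (intro the_equality) (auto simp: disjoint_family_on_def)
    then show ?thesis using that D(2)[OF that(1)] by (auto simp: \<gamma>_def)
  qed
  show thesis
  proof
    have "\<gamma> x \<in> {1..l}" if "x \<in> {1..n}" for x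
    proof (cases "\<exists>p<l. x \<in> D p")
      case True
      then show ?thesis using col by force
    next
      case False
      then have "\<gamma> x = 1" unfolding \<gamma>_def restrict_def using that by (simp only: if_True if_False)
      then show ?thesis using assms(3) by simp
    qed
    moreover have "\<gamma> \<in> extensional {1..n}" unfolding \<gamma>_def by (rule restrict_extensional)
    ultimately show "\<gamma> \<in> {1..n} \<rightarrow>\<^sub>E {1..l}" unfolding PiE_iff by blast
    fix b
    have disj: "disjoint_family_on D {..<m}"
      using D(1) assms(1) by (auto simp: disjoint_family_on_def)
    have "q ^ m \<le> card (transversals m D)"
      using D assms(1) by (intro card_transversals(2)[OF disj] finite_subset[OF D(2)]) auto
    also have "\<dots> \<le> card (atoms rainbow m n b \<gamma>)"
    proof (rule card_mono[OF finite_atoms], rule subsetI)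
      fix a assume a: "a \<in> transversals m D"
      obtain f where f: "\<And>p. p < m \<Longrightarrow> f p \<in> D p" "set a = f ` {..<m}" "length a = m"
        "sorted_wrt (<) a"
        using transversals_props[OF disj a] by metis
      have "\<gamma> (f p) = Suc p" if "p < m" for p
        using col[of p "f p"] f(1)[OF that] that assms(1) by simp
      then have "inj_on (\<gamma> \<circ> f) {..<m}" by (auto simp: inj_on_def)
      then have "inj_on \<gamma> (set a)" unfolding f(2) by (rule inj_on_imageI)
      moreover have "distinct a" using f(4) by (simp add: strict_sorted_iff)
      moreover have "f p \<in> {1..n}" if "p < m" for p
        using f(1)[OF that] D(2)[of p] that assms(1) by auto
      then have "set a \<subseteq> {1..n}" unfolding f(2) by blast
      ultimately show "a \<in> atoms rainbow m n b \<gamma>"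
        using f(3,4) unfolding atoms_def rainbow_def distinct_map by blast
    qed
    finally show "q ^ m \<le> card (atoms rainbow m n b \<gamma>)" .
  qed
qed

text \<open>
  With fewer than \<open>m\<close> large classes every rainbow tuple meets a small class, so there are few of
  them and a balanced colouring does better.
\<close>

lemma rainbow_improvable_few_large_classes:
  assumes lm: "2 \<le> m" "m \<le> l" and n: "real n \<ge> 2 * real l" and \<gamma>: "\<gamma> \<in> {1..n} \<rightarrow>\<^sub>E {1..l}"
    and \<delta>: "\<delta> = (1 / (2 * real l)) ^ m / (2 * real m * real l)"
    and few: "card {s \<in> {1..l}. real (card (\<gamma> -` {s} \<inter> {1..n})) \<ge> \<delta> * real n} < m"
  shows "improvable rainbow l m n ((1 / (2 * real l)) ^ m / 2) \<gamma>"
proof -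
  define \<kappa> where "\<kappa> = 1 / (2 * real l)"
  define q where "q = nat \<lfloor>1 / real l * real n\<rfloor>"
  have q: "\<kappa> * real n \<le> real q" "real q \<le> 1 / real l * real n"
    using half_floor_bound[of "1 / real l" n] n lm by (auto simp: q_def \<kappa>_def)
  have "real (l * q) \<le> real n" using q(2) lm by (simp add: field_simps)
  then have "l * q \<le> n" by linarith
  then obtain \<gamma>' where \<gamma>': "\<gamma>' \<in> {1..n} \<rightarrow>\<^sub>E {1..l}"
    "\<And>b. q ^ m \<le> card (atoms rainbow m n b \<gamma>')"
    using balanced_rainbow_atoms[of m l q n] lm by auto
  let ?S = "{s \<in> {1..l}. real (card (\<gamma> -` {s} \<inter> {1..n})) \<ge> \<delta> * real n}"
  \<comment> \<open>\<open>C\<close> collects the small classes. There are at most \<open>l\<close>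
    of them, so it has at most \<open>l * \<delta> * n\<close> elements.\<close>
  define C where "C = (\<Union>s\<in>{1..l} - ?S. \<gamma> -` {s} \<inter> {1..n})"
  have "card C \<le> (\<Sum>s\<in>{1..l} - ?S. card (\<gamma> -` {s} \<inter> {1..n}))"
    unfolding C_def by (rule card_UN_le) simp
  then have "real (card C) \<le> real (\<Sum>s\<in>{1..l} - ?S. card (\<gamma> -` {s} \<inter> {1..n}))"
    by (simp only: of_nat_le_iff)
  also have "\<dots> = (\<Sum>s\<in>{1..l} - ?S. real (card (\<gamma> -` {s} \<inter> {1..n})))" by simp
  also have "\<dots> \<le> (\<Sum>s\<in>{1..l} - ?S. \<delta> * real n)" by (intro sum_mono) auto
  also have "\<dots> = real (card ({1..l} - ?S)) * (\<delta> * real n)" by simp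
  also have "\<dots> \<le> real l * (\<delta> * real n)"
  proof (rule mult_right_mono)
    show "real (card ({1..l} - ?S)) \<le> real l"
      using card_mono[of "{1..l}" "{1..l} - ?S"] by auto
  qed (simp add: \<delta>)
  finally have C: "real (card C) \<le> real l * \<delta> * real n" by simp
  have meets: "card (atoms rainbow m n b \<gamma>) \<le> m * card C * n ^ (m - 1)" for b
  proof -
    have "set a \<inter> C \<noteq> {}" if a: "a \<in> atoms rainbow m n b \<gamma>" for a
    proof
      assume "set a \<inter> C = {}"
      then have "\<gamma> ` set a \<subseteq> ?S" using a \<gamma> by (fastforce simp: C_def atoms_def PiE_iff)
      then have "card (\<gamma> ` set a) \<le> card ?S" by (intro card_mono) auto
      moreover have "card (\<gamma> ` set a) = m"
        using a distinct_card[of "map \<gamma> a"] by (simp add: atoms_def rainbow_def)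
      ultimately show False using few by simp
    qed
    then have "atoms rainbow m n b \<gamma> \<subseteq>
        {a. length a = m \<and> set a \<subseteq> {1..n} \<and> set a \<inter> C \<noteq> {}}"
      by (auto simp: atoms_def)
    then have "card (atoms rainbow m n b \<gamma>) \<le>
        card {a. length a = m \<and> set a \<subseteq> {1..n} \<and> set a \<inter> C \<noteq> {}}"
      by (intro card_mono finite_tuples)
    also have "\<dots> \<le> m * card C * n ^ (m - 1)"
      by (rule card_lists_meeting_le) (simp add: C_def)
    finally show ?thesis .
  qed
  \<comment> \<open>Here two unrelated colourings are compared: the bound on all atoms of
    \<open>\<gamma>\<close> takes the place of the loss, and \<open>q ^ m\<close> bounds the atoms
    of \<open>\<gamma>'\<close> from below. The value of \<open>\<delta>\<close> makes
    \<open>l * \<delta>\<close> equal to the threshold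
    \<open>\<kappa> ^ m / (2 * m)\<close>.\<close>
  have "real (card (atoms rainbow m n b \<gamma>)) + \<kappa> ^ m / 2 * real n ^ m
      \<le> real (card (atoms rainbow m n b \<gamma>'))" for b
  proof (rule gain_absorbs_loss)
    show "card (atoms rainbow m n b \<gamma>) + q ^ m
        \<le> card (atoms rainbow m n b \<gamma>') + m * card C * n ^ (m - 1)"
      using meets \<gamma>'(2) by (simp add: add_mono add.commute)
    show "real (card C) \<le> (real l * \<delta>) * real n" by (rule C)
    show "real l * \<delta> \<le> \<kappa> ^ m / (2 * real m)" using lm by (simp add: \<delta> \<kappa>_def)
  qed (use lm q \<kappa>_def in auto)
  then show ?thesis using \<gamma>'(1) unfolding improvable_def \<kappa>_def by blast
qed

text \<open>
  With \<open>m\<close> large classes, one of them is split into \<open>D 0\<close> and \<open>D 1\<close>, and \<open>D 0\<close> gets the colour \<open>i\<close>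
  of the small class. This gains the tuples with entries in \<open>D 0\<close>, \<open>D 1\<close> and \<open>m - 2\<close> other large
  classes, and it loses only tuples that meet the old small class.
\<close>

lemma rainbow_improvable_many_large_classes:
  assumes lm: "2 \<le> m" "m \<le> l" and n: "real n \<ge> 4 / \<delta>" and \<gamma>: "\<gamma> \<in> {1..n} \<rightarrow>\<^sub>E {1..l}"
    and \<delta>: "\<delta> > 0" and \<mu>: "\<mu> \<le> \<delta>" "\<mu> \<le> (\<delta> / 4) ^ m / (2 * real m)"
    and many: "m \<le> card {s \<in> {1..l}. real (card (\<gamma> -` {s} \<inter> {1..n})) \<ge> \<delta> * real n}"
    and not_rich: "\<not> rich l n (\<mu> * real n) \<gamma>"
  shows "improvable rainbow l m n ((\<delta> / 4) ^ m / 2) \<gamma>"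
proof -
  let ?cl = "\<lambda>s. \<gamma> -` {s} \<inter> {1..n}"
  obtain i where i: "i \<in> {1..l}" "real (card (?cl i)) < \<mu> * real n"
    using not_rich by (auto simp: rich_def)
  obtain T where T: "T \<subseteq> {s \<in> {1..l}. real (card (?cl s)) \<ge> \<delta> * real n}" "card T = m" "finite T"
    by (rule obtain_subset_with_card_n[OF many])
  obtain e where e: "bij_betw e {0..<m} T"
    using ex_bij_betw_nat_finite[OF T(3)] T(2) by blast
  have e_big: "real (card (?cl (e p))) \<ge> \<delta> * real n" if "p < m" for p
    using e T(1) that by (fastforce simp: bij_betw_def)
  have e_inj: "e p = e p' \<longleftrightarrow> p = p'" if "p < m" "p' < m" for p p'
    using e that by (auto simp: bij_betw_def inj_on_def)
  \<comment> \<open>Since \<open>\<mu> \<le> \<delta>\<close>, the small colour \<open>i\<close> is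
    not among the \<open>m\<close> large colours in \<open>T\<close>.\<close>
  have "\<mu> * real n \<le> \<delta> * real n" using \<mu>(1) by (intro mult_right_mono) auto
  then have e_ne: "e p \<noteq> i" if "p < m" for p using e_big[OF that] i(2) by auto
  define q where "q = nat \<lfloor>\<delta> / 2 * real n\<rfloor>"
  have q: "\<delta> / 4 * real n \<le> real q" "real q \<le> \<delta> / 2 * real n"
    using half_floor_bound[of "\<delta> / 2" n] \<delta> n by (auto simp: q_def)
  have "real (2 * q) \<le> real (card (?cl (e 1)))" using q(2) e_big[of 1] lm by simp
  then have "2 * q \<le> card (?cl (e 1))" by (simp only: of_nat_le_iff)
  then obtain E :: "nat \<Rightarrow> nat set" where E: "disjoint_family_on E {..<2}" "\<And>p. p < 2 \<Longrightarrow> E p \<subseteq> ?cl (e 1)"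
    "\<And>p. p < 2 \<Longrightarrow> card (E p) = q"
    using split_into_equal_parts[of "?cl (e 1)" 2 q] by auto
  \<comment> \<open>\<open>D 0\<close> and \<open>D 1\<close> both come from the class of colour
    \<open>e 1\<close>, and each later \<open>D p\<close> is the whole class of colour
    \<open>e p\<close>. So the old colour on \<open>D p\<close> is
    \<open>e (max 1 p)\<close>.\<close>
  define D where "D p = (if p < 2 then E p else ?cl (e p))" for p
  have D_sub: "D p \<subseteq> ?cl (e (max 1 p))" for p
    using E(2)[of p] by (cases "p < 2") (auto simp: D_def max_def split: if_splits
      dest!: less_2_cases)
  have D_col: "\<gamma> x = e (max 1 p)" if "x \<in> D p" for x p
    using subsetD[OF D_sub that] by simp
  have D_card: "q \<le> card (D p)" if "p < m" for p
  proof (cases "p < 2")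
    case True
    then show ?thesis using E(3) by (simp add: D_def)
  next
    case False
    have "real q \<le> \<delta> * real n" using \<delta> by (intro order_trans[OF q(2)] mult_right_mono) auto
    also note e_big[OF that]
    finally show ?thesis using False by (simp add: D_def)
  qed
  have D_disj: "disjoint_family_on D {..<m}"
    unfolding disjoint_family_on_def
  proof (intro ballI impI)
    fix p p' assume p: "p \<in> {..<m}" "p' \<in> {..<m}" "p \<noteq> p'"
    show "D p \<inter> D p' = {}"
    proof (cases "p < 2 \<and> p' < 2")
      case True
      then show ?thesis using E(1) p by (auto simp: D_def disjoint_family_on_def)
    next
      case False
      then have "e (max 1 p) \<noteq> e (max 1 p')"
        using e_inj[of "max 1 p" "max 1 p'"] p lm by (auto simp: max_def split: if_splits)
      then show ?thesis using D_col[of _ p] D_col[of _ p'] by (metis disjoint_iff)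
    qed
  qed
  let ?\<gamma>' = "recolour (D 0) i \<gamma>"
  have D0: "\<And>x. x \<in> D 0 \<Longrightarrow> \<gamma> x = e 1" using D_col[of _ 0] by simp
  have lost: "set a \<inter> ?cl i \<noteq> {}"
    if "set a \<subseteq> {1..n}" "rainbow \<gamma> a" "\<not> rainbow ?\<gamma>' a" for a
    using rainbow_lost[OF D0 that(2,3)] that(1) by auto
  have won: "rainbow ?\<gamma>' a \<and> \<not> rainbow \<gamma> a" if a: "a \<in> transversals m D" for a
  proof -
    obtain f where f: "\<And>p. p < m \<Longrightarrow> f p \<in> D p" "set a = f ` {..<m}" "inj_on f {..<m}"
      "sorted_wrt (<) a"
      using transversals_props[OF D_disj a] by metis
    have \<gamma>f: "\<gamma> (f p) = e (max 1 p)" if "p < m" for p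
      using D_col[OF f(1)[OF that]] .
    \<comment> \<open>The new colours are \<open>i\<close>, \<open>e 1\<close>, ...,
      \<open>e (m - 1)\<close>, all distinct, whereas \<open>f 0\<close> and \<open>f 1\<close> used
      to share the colour \<open>e 1\<close>.\<close>
    have "?\<gamma>' (f p) = (if p = 0 then i else e p)" if "p < m" for p
    proof (cases "p = 0")
      case True
      then show ?thesis using f(1)[OF that] by (simp add: recolour_def)
    next
      case False
      then have "D p \<inter> D 0 = {}" using D_disj that by (auto simp: disjoint_family_on_def)
      then show ?thesis using f(1)[OF that] \<gamma>f[OF that] False by (auto simp: recolour_def max_def)
    qed
    then have "inj_on (?\<gamma>' \<circ> f) {..<m}"
      using e_ne e_inj by (auto simp: inj_on_def split: if_splits)
    then have "inj_on ?\<gamma>' (set a)" unfolding f(2) by (rule inj_on_imageI)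
    moreover have "distinct a" using f(4) by (simp add: strict_sorted_iff)
    ultimately have "rainbow ?\<gamma>' a" by (simp add: rainbow_def distinct_map)
    moreover have "f 0 \<in> set a" "f 1 \<in> set a" using f(2) lm by auto
    moreover have "f 0 \<noteq> f 1" using inj_onD[OF f(3), of 0 1] lm by auto
    moreover have "\<gamma> (f 0) = \<gamma> (f 1)" using \<gamma>f[of 0] \<gamma>f[of 1] lm by simp
    ultimately show ?thesis unfolding rainbow_def distinct_map inj_on_def by blast
  qed
  have "card (atoms rainbow m n b \<gamma>) + q ^ m
    \<le> card (atoms rainbow m n b ?\<gamma>') + m * card (?cl i) * n ^ (m - 1)" for b
    by (rule recolour_gain[OF lost D_disj _ _ won]) (use D_sub D_card in auto)
  then have "real (card (atoms rainbow m n b \<gamma>)) + (\<delta> / 4) ^ m / 2 * real n ^ m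
    \<le> real (card (atoms rainbow m n b ?\<gamma>'))" for b
    by (rule gain_absorbs_loss[OF _ _ _ \<mu>(2)]) (use lm i(2) \<delta> q(1) in auto)
  moreover have "?\<gamma>' \<in> {1..n} \<rightarrow>\<^sub>E {1..l}"
    by (rule recolour_PiE[OF \<gamma> _ i(1)]) (use D_sub[of 0] in auto)
  ultimately show ?thesis
    unfolding improvable_def by blast
qed

text \<open>The two cases are separated by the number of classes with at least
  \<open>\<delta> * n\<close> elements. The case of few large classes dictates
  \<open>\<delta>\<close>, then \<open>\<mu>\<close> is chosen for the other case, and
  \<open>c\<close> is the smaller of the two gains.\<close>

lemma rainbow_improvable:
  assumes lm: "2 \<le> m" "m \<le> l"
  shows "\<exists>\<mu>>0. \<exists>c>0. \<forall>\<^sub>F n in sequentially. \<forall>\<gamma>\<in>{1..n} \<rightarrow>\<^sub>E {1..l}.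
    \<not> rich l n (\<mu> * real n) \<gamma> \<longrightarrow> improvable rainbow l m n c \<gamma>"
proof -
  define \<delta> where "\<delta> = (1 / (2 * real l)) ^ m / (2 * real m * real l)"
  define \<mu> where "\<mu> = min \<delta> ((\<delta> / 4) ^ m / (2 * real m))"
  define c where "c = min ((1 / (2 * real l)) ^ m / 2) ((\<delta> / 4) ^ m / 2)"
  have \<delta>: "\<delta> > 0" using lm by (simp add: \<delta>_def)
  then have pos: "\<mu> > 0" "c > 0" using lm by (auto simp: \<mu>_def c_def)
  have "\<forall>\<^sub>F n in sequentially. \<forall>\<gamma>\<in>{1..n} \<rightarrow>\<^sub>E {1..l}.
    \<not> rich l n (\<mu> * real n) \<gamma> \<longrightarrow> improvable rainbow l m n c \<gamma>"
    using eventually_nat_ge[of "2 * real l"] eventually_nat_ge[of "4 / \<delta>"]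
  proof eventually_elim
    case (elim n)
    show ?case
    proof (intro ballI impI)
      fix \<gamma> assume \<gamma>: "\<gamma> \<in> {1..n} \<rightarrow>\<^sub>E {1..l}" and nr: "\<not> rich l n (\<mu> * real n) \<gamma>"
      show "improvable rainbow l m n c \<gamma>"
      proof (cases "card {s \<in> {1..l}. real (card (\<gamma> -` {s} \<inter> {1..n})) \<ge> \<delta> * real n} < m")
        case True
        show ?thesis
          by (rule improvable_mono[OF rainbow_improvable_few_large_classes[OF lm elim(1) \<gamma> \<delta>_def True]])
            (simp add: c_def)
      next
        case False
        then have many: "m \<le> card {s \<in> {1..l}. real (card (\<gamma> -` {s} \<inter> {1..n})) \<ge> \<delta> * real n}"
          by simp
        show ?thesis
          by (rule improvable_mono[OF rainbow_improvable_many_large_classes[OF lm elim(2) \<gamma> \<delta> _ _ many nr]])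
            (simp_all add: c_def \<mu>_def)
      qed
    qed
  qed
  then show ?thesis using pos by blast
qed

section \<open>From improvable colourings to proportions\<close>

text \<open>Relations of arity \<open>m\<close> do not lose, and \<open>k0\<close> gains
  \<open>c * n ^ m\<close>. A relation of smaller arity has at most \<open>n ^ (m - 1)\<close> atoms
  to lose, and one of larger arity has none.\<close>

lemma total_gain:
  assumes imp: "improvable g l m n c \<gamma>" and k0: "k0 \<in> {1..\<rho>}" "r k0 = m" and n: "n \<ge> 1"
    and c: "c \<ge> 0"
    and high: "\<And>k \<gamma> b. k \<in> {1..\<rho>} \<Longrightarrow> r k > m \<Longrightarrow> \<gamma> \<in> {1..n} \<rightarrow>\<^sub>E {1..l} \<Longrightarrow> atoms g (r k) n b \<gamma> = {}"
    and \<gamma>: "\<gamma> \<in> {1..n} \<rightarrow>\<^sub>E {1..l}"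
  obtains \<gamma>' where "\<gamma>' \<in> {1..n} \<rightarrow>\<^sub>E {1..l}"
    "real (\<Sum>k\<in>{1..\<rho>}. card (atoms g (r k) n (k \<in> I) \<gamma>)) + c * real n ^ m
      \<le> real (\<Sum>k\<in>{1..\<rho>}. card (atoms g (r k) n (k \<in> I) \<gamma>')) + real \<rho> * real n ^ (m - 1)"
proof -
  obtain \<gamma>' where \<gamma>': "\<gamma>' \<in> {1..n} \<rightarrow>\<^sub>E {1..l}"
    "\<And>b. real (card (atoms g m n b \<gamma>)) + c * real n ^ m \<le> real (card (atoms g m n b \<gamma>'))"
    using imp unfolding improvable_def by blast
  let ?N = "\<lambda>\<gamma> k. real (card (atoms g (r k) n (k \<in> I) \<gamma>))"
  have "?N \<gamma> k + (if k = k0 then c * real n ^ m else 0) \<le> ?N \<gamma>' k + real n ^ (m - 1)"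
    if k: "k \<in> {1..\<rho>}" for k
  proof -
    consider "r k = m" | "r k < m" | "r k > m" by linarith
    then show ?thesis
    proof cases
      case 1
      have "0 \<le> c * real n ^ m" "0 \<le> real n ^ (m - 1)" using c by auto
      moreover have "?N \<gamma> k + c * real n ^ m \<le> ?N \<gamma>' k" unfolding 1 by (rule \<gamma>'(2))
      ultimately show ?thesis by (split if_split, intro conjI impI) linarith+
    next
      case 2
      have "card (atoms g (r k) n (k \<in> I) \<gamma>) \<le> n ^ r k" by (rule card_atoms_le)
      also have "\<dots> \<le> n ^ (m - 1)" using 2 n by (intro power_increasing) auto
      finally have "?N \<gamma> k \<le> real n ^ (m - 1)" by (simp only: of_nat_power[symmetric] of_nat_le_iff)
      moreover have "k \<noteq> k0" using 2 k0(2) by auto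
      ultimately show ?thesis by (subst if_not_P) linarith+
    next
      case 3
      then have "k \<noteq> k0" using k0(2) by auto
      then show ?thesis using high[OF k 3 \<gamma>] by simp
    qed
  qed
  then have "(\<Sum>k\<in>{1..\<rho>}. ?N \<gamma> k + (if k = k0 then c * real n ^ m else 0))
    \<le> (\<Sum>k\<in>{1..\<rho>}. ?N \<gamma>' k + real n ^ (m - 1))"
    by (rule sum_mono)
  then have "(\<Sum>k\<in>{1..\<rho>}. ?N \<gamma> k) + c * real n ^ m
    \<le> (\<Sum>k\<in>{1..\<rho>}. ?N \<gamma>' k) + real \<rho> * real n ^ (m - 1)"
    using k0(1) by (simp add: sum.distrib)
  with \<gamma>'(1) show thesis by (intro that[of \<gamma>']) simp_all
qed

text \<open>From \<open>l \<le> 2 ^ l\<close> there are at most \<open>2 powr (l * n)\<close>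
  colourings. Since \<open>m \<ge> 2\<close>, the exponent \<open>l * n\<close> is at most
  \<open>l * n ^ (m - 1)\<close>, which is eventually below half of
  \<open>c * n ^ m\<close>.\<close>

lemma union_bound_negligible:
  assumes "c > 0" "m \<ge> 2"
  shows "\<forall>\<^sub>F n in sequentially.
    real l ^ n * 2 powr (- (c * real n ^ m)) \<le> 2 powr (- (c / 2 * real n ^ m))"
proof -
  have m: "m > 0" and c: "c / 2 > 0" using assms by auto
  show ?thesis
    using eventually_power_bound[OF c m, of "real l"] eventually_gt_at_top[of 0]
  proof eventually_elim
    case (elim n)
    have "real n ^ 1 \<le> real n ^ (m - 1)" using elim(2) assms(2) by (intro power_increasing) auto
    then have "real l * real n \<le> real l * real n ^ (m - 1)" by (intro mult_left_mono) auto
    with elim(1) have ln: "real l * real n \<le> c / 2 * real n ^ m" by linarith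
    have "real l \<le> 2 ^ l"
      using of_nat_less_two_power[of l, where 'a = real] by simp
    then have "real l ^ n \<le> (2 ^ l) ^ n" by (intro power_mono) auto
    also have "\<dots> = 2 powr (real l * real n)"
      by (simp add: powr_realpow[symmetric] powr_powr)
    finally have "real l ^ n * 2 powr (- (c * real n ^ m))
        \<le> 2 powr (real l * real n) * 2 powr (- (c * real n ^ m))"
      by (intro mult_right_mono) auto
    also have "\<dots> = 2 powr (real l * real n - c * real n ^ m)"
      by (simp flip: powr_add)
    also have "\<dots> \<le> 2 powr (- (c / 2 * real n ^ m))"
      by (rule powr_mono) (use ln in \<open>simp_all add: field_simps\<close>)
    finally show ?case .
  qed
qed

text \<open>Since \<open>n \<le> n ^ m\<close> for positive \<open>n\<close>, the sequence lies
  below a geometric one with ratio \<open>2 powr (- lam)\<close>.\<close>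

lemma powr_neg_power_tendsto_0:
  assumes "lam > 0" "m \<ge> 1"
  shows "(\<lambda>n. 2 powr (- (lam * real n ^ m))) \<longlonglongrightarrow> 0"
proof (rule tendsto_sandwich[OF _ _ tendsto_const LIMSEQ_realpow_zero])
  show "\<forall>\<^sub>F n in sequentially. 2 powr (- (lam * real n ^ m)) \<le> (2 powr (- lam)) ^ n"
    using eventually_gt_at_top[of 0]
  proof eventually_elim
    case (elim n)
    have "real n ^ 1 \<le> real n ^ m" using elim assms(2) by (intro power_increasing) auto
    then have "2 powr (- (lam * real n ^ m)) \<le> 2 powr (- lam * real n)"
      using assms(1) by (intro powr_mono) auto
    also have "\<dots> = (2 powr (- lam)) ^ n"
      by (simp only: powr_powr[symmetric]) (simp add: powr_realpow)
    finally show ?case .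
  qed
  show "2 powr (- lam) < 1" using assms(1) powr_less_mono[of "- lam" 0 2] by simp
qed auto

text \<open>This is the common frame for both kinds of colouring: \<open>col\<close> is the kind and
  \<open>g\<close> its condition on tuples. Specific to each kind are \<open>imp\<close>, the gain
  in arity \<open>m\<close>, and \<open>high\<close>, the absence of atoms of larger arity.\<close>

lemma almost_all_colourings_rich:
  fixes g :: "(nat \<Rightarrow> nat) \<Rightarrow> nat list \<Rightarrow> bool"
  assumes inv: "\<And>\<gamma> a b. mset a = mset b \<Longrightarrow> g \<gamma> a = g \<gamma> b" and I: "I \<subseteq> {1..\<rho>}"
    and l: "l \<ge> 1" and m: "m \<ge> 2" and k0: "k0 \<in> {1..\<rho>}" "r k0 = m"
    and high: "\<And>k n \<gamma> b. k \<in> {1..\<rho>} \<Longrightarrow> r k > m \<Longrightarrow> \<gamma> \<in> {1..n} \<rightarrow>\<^sub>E {1..l} \<Longrightarrow>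
      atoms g (r k) n b \<gamma> = {}"
    and imp: "\<exists>\<mu>>0. \<exists>c>0. \<forall>\<^sub>F n in sequentially. \<forall>\<gamma>\<in>{1..n} \<rightarrow>\<^sub>E {1..l}.
      \<not> rich l n (\<mu> * real n) \<gamma> \<longrightarrow> improvable g l m n c \<gamma>"
    and X: "\<And>n. X n = {R \<in> structures \<rho> r {1..n}. (\<exists>\<gamma>. col n R \<gamma>) \<and>
      (\<forall>k\<in>I. irreflexive_rel (R k) \<and> symmetric_rel (R k))}"
    and col: "\<And>n R \<gamma>. col n R \<gamma> \<longleftrightarrow>
      \<gamma> \<in> {1..n} \<rightarrow>\<^sub>E {1..l} \<and> (\<forall>k\<in>{1..\<rho>}. \<forall>a\<in>R k. g \<gamma> a)"
  shows "\<exists>\<mu>>0. \<exists>lam>0.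
    (\<forall>\<^sub>F n in sequentially. proportion (X n) (\<lambda>R. \<exists>\<gamma>. col n R \<gamma> \<and> \<not> rich l n (\<mu> * real n) \<gamma>)
      \<le> 2 powr (- (lam * real n ^ m))) \<and>
    (\<lambda>n. proportion (X n) (\<lambda>R. \<forall>\<gamma>. col n R \<gamma> \<longrightarrow> rich l n (\<mu> * real n) \<gamma>)) \<longlonglongrightarrow> 1"
proof -
  obtain \<mu> c where \<mu>: "\<mu> > 0" and c: "c > 0" and ev: "\<forall>\<^sub>F n in sequentially. \<forall>\<gamma>\<in>{1..n} \<rightarrow>\<^sub>E {1..l}.
      \<not> rich l n (\<mu> * real n) \<gamma> \<longrightarrow> improvable g l m n c \<gamma>"
    using imp by blast
  let ?\<Gamma> = "\<lambda>n. {1..n} \<rightarrow>\<^sub>E {1..l}"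
  let ?bad = "\<lambda>n R. \<exists>\<gamma>. col n R \<gamma> \<and> \<not> rich l n (\<mu> * real n) \<gamma>"
  have col_eq: "col n R = (\<lambda>\<gamma>. \<gamma> \<in> ?\<Gamma> n \<and> (\<forall>k\<in>{1..\<rho>}. \<forall>a\<in>R k. g \<gamma> a))" for n R
    by (rule ext) (rule col)
  have X_models: "X n = (\<Union>\<gamma>\<in>?\<Gamma> n. models g \<rho> r I n \<gamma>)" for n
    unfolding X models_def col_eq by blast
  have bad_models: "{R \<in> X n. ?bad n R} =
      {R \<in> X n. \<exists>\<gamma>\<in>?\<Gamma> n. R \<in> models g \<rho> r I n \<gamma> \<and> \<not> rich l n (\<mu> * real n) \<gamma>}" for n
    unfolding X models_def col_eq by blast
  \<comment> \<open>Half of \<open>c\<close> pays for the tuples of smaller arity, and half of the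
    remainder for the \<open>l ^ n\<close> colourings, so \<open>c / 4\<close> is left as the final
    constant.\<close>
  have c2: "c / 2 > 0" and m0: "m > 0" using c m by auto
  have bounds: "\<forall>\<^sub>F n in sequentially. finite (X n) \<and> X n \<noteq> {} \<and>
      proportion (X n) (?bad n) \<le> 2 powr (- (c / 4 * real n ^ m))"
    using ev eventually_power_bound[OF c2 m0, of "real \<rho>"] eventually_gt_at_top[of 0]
      union_bound_negligible[OF c2 m, of l]
  proof eventually_elim
    case (elim n)
    have gain: "\<exists>\<gamma>'\<in>?\<Gamma> n. real (\<Sum>k\<in>{1..\<rho>}. card (atoms g (r k) n (k \<in> I) \<gamma>)) + c / 2 * real n ^ m
        \<le> real (\<Sum>k\<in>{1..\<rho>}. card (atoms g (r k) n (k \<in> I) \<gamma>'))"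
      if \<gamma>: "\<gamma> \<in> ?\<Gamma> n" "\<not> rich l n (\<mu> * real n) \<gamma>" for \<gamma>
    proof -
      have "improvable g l m n c \<gamma>" using elim(1) \<gamma> by blast
      then obtain \<gamma>' where \<gamma>': "\<gamma>' \<in> ?\<Gamma> n"
        "real (\<Sum>k\<in>{1..\<rho>}. card (atoms g (r k) n (k \<in> I) \<gamma>)) + c * real n ^ m
          \<le> real (\<Sum>k\<in>{1..\<rho>}. card (atoms g (r k) n (k \<in> I) \<gamma>')) + real \<rho> * real n ^ (m - 1)"
        by (rule total_gain[of g l m n c \<gamma> k0 \<rho> r I, OF _ k0 _ _ high \<gamma>(1)])
          (use elim(3) c in auto)
      have "c * real n ^ m = c / 2 * real n ^ m + c / 2 * real n ^ m" by simp
      with \<gamma>'(2) elim(2) show ?thesis by (intro bexI[OF _ \<gamma>'(1)]) linarith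
    qed
    have nonneg: "c / 2 * real n ^ m \<ge> 0" using c by simp
    note ub = union_bound_proportion[of g I \<rho> l "c / 2 * real n ^ m" n
        "\<lambda>\<gamma>. \<not> rich l n (\<mu> * real n) \<gamma>" r, OF inv I l nonneg gain, folded X_models]
    have "proportion (X n) (?bad n) \<le> real l ^ n * 2 powr (- (c / 2 * real n ^ m))"
      using ub(1) unfolding proportion_def bad_models .
    also have "\<dots> \<le> 2 powr (- (c / 4 * real n ^ m))" using elim(4) by simp
    finally show ?case using ub(2,3) by blast
  qed
  have "(\<lambda>n. proportion (X n) (?bad n)) \<longlonglongrightarrow> 0"
  proof (rule tendsto_sandwich[OF _ _ tendsto_const])
    show "\<forall>\<^sub>F n in sequentially. proportion (X n) (?bad n) \<le> 2 powr (- (c / 4 * real n ^ m))"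
      using bounds by eventually_elim blast
    show "(\<lambda>n. 2 powr (- (c / 4 * real n ^ m))) \<longlonglongrightarrow> 0"
      by (rule powr_neg_power_tendsto_0) (use c m in auto)
  qed (simp add: proportion_def)
  then have "(\<lambda>n. 1 - proportion (X n) (?bad n)) \<longlonglongrightarrow> 1 - 0"
    by (intro tendsto_intros)
  moreover have "\<forall>\<^sub>F n in sequentially. 1 - proportion (X n) (?bad n) =
      proportion (X n) (\<lambda>R. \<forall>\<gamma>. col n R \<gamma> \<longrightarrow> rich l n (\<mu> * real n) \<gamma>)"
    using bounds
  proof eventually_elim
    case (elim n)
    then show ?case using proportion_not[of "X n" "?bad n"] by simp
  qed
  ultimately have "(\<lambda>n. proportion (X n) (\<lambda>R. \<forall>\<gamma>. col n R \<gamma> \<longrightarrow> rich l n (\<mu> * real n) \<gamma>)) \<longlonglongrightarrow> 1"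
    by (simp add: tendsto_cong)
  moreover have "\<forall>\<^sub>F n in sequentially. proportion (X n) (?bad n) \<le> 2 powr (- (c / 4 * real n ^ m))"
    using bounds by eventually_elim blast
  ultimately show ?thesis using \<mu> c by (intro exI[of _ \<mu>] conjI exI[of _ "c / 4"]) auto
qed

section \<open>Both kinds of colouring as conditions on single tuples\<close>

lemma nonconstant_mset: "mset a = mset b \<Longrightarrow> nonconstant \<gamma> a = nonconstant \<gamma> b"
  by (auto simp: nonconstant_def dest: mset_eq_setD)

lemma rainbow_mset: "mset a = mset b \<Longrightarrow> rainbow \<gamma> a = rainbow \<gamma> b"
  unfolding rainbow_def by (rule mset_eq_imp_distinct_iff) simp

lemma colouring_iff_nonconstant:
  "colouring l \<rho> U R \<gamma> \<longleftrightarrow> \<gamma> \<in> U \<rightarrow>\<^sub>E {1..l} \<and> (\<forall>k\<in>{1..\<rho>}. \<forall>a\<in>R k. nonconstant \<gamma> a)"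
proof -
  have "(\<exists>x\<in>set a. P x) \<longleftrightarrow> (\<exists>i<length a. P (a ! i))" for P and a :: "nat list"
    by (auto simp: set_conv_nth)
  then show ?thesis unfolding colouring_def nonconstant_def by simp
qed

lemma strong_colouring_iff_rainbow:
  "strong_colouring l \<rho> U R \<gamma> \<longleftrightarrow> \<gamma> \<in> U \<rightarrow>\<^sub>E {1..l} \<and> (\<forall>k\<in>{1..\<rho>}. \<forall>a\<in>R k. rainbow \<gamma> a)"
  by (simp add: strong_colouring_def rainbow_def distinct_conv_nth)

text \<open>A rainbow tuple needs as many colours as it has entries. This is why only arities at
  most \<open>l\<close> count for strong colourings.\<close>

lemma rainbow_atoms_empty:
  assumes "s > l" "\<gamma> \<in> {1..n} \<rightarrow>\<^sub>E {1..l}"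
  shows "atoms rainbow s n b \<gamma> = {}"
proof (rule equals0I)
  fix a assume a: "a \<in> atoms rainbow s n b \<gamma>"
  then have "\<gamma> ` set a \<subseteq> {1..l}" using assms(2) by (auto simp: atoms_def PiE_iff)
  then have "card (\<gamma> ` set a) \<le> card {1..l}" by (intro card_mono) auto
  moreover have "card (\<gamma> ` set a) = s"
    using a distinct_card[of "map \<gamma> a"] by (simp add: atoms_def rainbow_def)
  ultimately show False using assms(1) by simp
qed

theorem theorem10p5:
  fixes l \<rho> :: nat and r :: "nat \<Rightarrow> nat"
  assumes "l \<ge> 2" and "\<rho> > 0" and "\<forall>k\<in>{1..\<rho>}. r k \<ge> 2"
  shows
    "(\<forall>I\<subseteq>{1..\<rho>}. \<exists>\<mu>>0. \<exists>lam>0.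
        (\<forall>\<^sub>F n in sequentially.
           proportion (colourable_structures l \<rho> r I n)
             (\<lambda>R. \<exists>\<gamma>. colouring l \<rho> {1..n} R \<gamma> \<and> \<not> rich l n (\<mu> * real n) \<gamma>)
           \<le> 2 powr (- (lam * real n ^ Max (r ` {1..\<rho>})))) \<and>
        (\<lambda>n. proportion (colourable_structures l \<rho> r I n)
             (\<lambda>R. \<forall>\<gamma>. colouring l \<rho> {1..n} R \<gamma> \<longrightarrow> rich l n (\<mu> * real n) \<gamma>))
          \<longlonglongrightarrow> 1)
     \<and>
     ((\<exists>k\<in>{1..\<rho>}. r k \<le> l) \<longrightarrow>
      (\<forall>I\<subseteq>{1..\<rho>}. \<exists>\<mu>>0. \<exists>lam>0.
        (\<forall>\<^sub>F n in sequentially.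
           proportion (strongly_colourable_structures l \<rho> r I n)
             (\<lambda>R. \<exists>\<gamma>. strong_colouring l \<rho> {1..n} R \<gamma> \<and> \<not> rich l n (\<mu> * real n) \<gamma>)
           \<le> 2 powr (- (lam * real n ^ Max {r k | k. k \<in> {1..\<rho>} \<and> r k \<le> l}))) \<and>
        (\<lambda>n. proportion (strongly_colourable_structures l \<rho> r I n)
             (\<lambda>R. \<forall>\<gamma>. strong_colouring l \<rho> {1..n} R \<gamma> \<longrightarrow> rich l n (\<mu> * real n) \<gamma>))
          \<longlonglongrightarrow> 1))"
proof (intro conjI allI impI)
  fix I assume I: "I \<subseteq> {1..\<rho>}"
  define m where "m = Max (r ` {1..\<rho>})"
  have "m \<in> r ` {1..\<rho>}" unfolding m_def using assms(2) by (intro Max_in) auto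
  then obtain k0 where k0: "k0 \<in> {1..\<rho>}" "r k0 = m" by auto
  \<comment> \<open>No arity exceeds \<open>m\<close>, so the hypothesis \<open>high\<close> of
    \<open>almost_all_colourings_rich\<close> holds vacuously.\<close>
  have m_ge: "r k \<le> m" if "k \<in> {1..\<rho>}" for k unfolding m_def using that by (intro Max_ge) auto
  have l: "l \<ge> 1" and m: "m \<ge> 2" using assms k0 by auto
  show "\<exists>\<mu>>0. \<exists>lam>0.
      (\<forall>\<^sub>F n in sequentially.
         proportion (colourable_structures l \<rho> r I n)
           (\<lambda>R. \<exists>\<gamma>. colouring l \<rho> {1..n} R \<gamma> \<and> \<not> rich l n (\<mu> * real n) \<gamma>)
         \<le> 2 powr (- (lam * real n ^ Max (r ` {1..\<rho>})))) \<and>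
      (\<lambda>n. proportion (colourable_structures l \<rho> r I n)
           (\<lambda>R. \<forall>\<gamma>. colouring l \<rho> {1..n} R \<gamma> \<longrightarrow> rich l n (\<mu> * real n) \<gamma>))
        \<longlonglongrightarrow> 1"
    unfolding m_def[symmetric]
    by (rule almost_all_colourings_rich[where g = nonconstant and r = r, OF nonconstant_mset I l m k0
          _ nonconstant_improvable[OF assms(1) m]])
      (use m_ge in \<open>force simp: colourable_structures_def colouring_iff_nonconstant\<close>)+
next
  fix I assume I: "I \<subseteq> {1..\<rho>}" and ex: "\<exists>k\<in>{1..\<rho>}. r k \<le> l"
  let ?A = "{r k | k. k \<in> {1..\<rho>} \<and> r k \<le> l}"
  have fin: "finite ?A" by simp
  define m where "m = Max ?A"
  have "m \<in> ?A" unfolding m_def using ex by (intro Max_in[OF fin]) blast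
  then obtain k0 where k0: "k0 \<in> {1..\<rho>}" "r k0 = m" and ml: "m \<le> l" by auto
  \<comment> \<open>As \<open>m\<close> is maximal among the arities at most \<open>l\<close>, any
    arity above \<open>m\<close> exceeds \<open>l\<close>, so \<open>rainbow_atoms_empty\<close>
    applies to it.\<close>
  have high: "r k > l" if "k \<in> {1..\<rho>}" "r k > m" for k
  proof (rule ccontr)
    assume "\<not> r k > l"
    then have "r k \<le> m" unfolding m_def using that(1) by (intro Max_ge[OF fin]) auto
    then show False using that(2) by simp
  qed
  have l: "l \<ge> 1" and m: "m \<ge> 2" using assms k0 by auto
  show "\<exists>\<mu>>0. \<exists>lam>0.
      (\<forall>\<^sub>F n in sequentially.
         proportion (strongly_colourable_structures l \<rho> r I n)
           (\<lambda>R. \<exists>\<gamma>. strong_colouring l \<rho> {1..n} R \<gamma> \<and> \<not> rich l n (\<mu> * real n) \<gamma>)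
         \<le> 2 powr (- (lam * real n ^ Max ?A))) \<and>
      (\<lambda>n. proportion (strongly_colourable_structures l \<rho> r I n)
           (\<lambda>R. \<forall>\<gamma>. strong_colouring l \<rho> {1..n} R \<gamma> \<longrightarrow> rich l n (\<mu> * real n) \<gamma>))
        \<longlonglongrightarrow> 1"
    unfolding m_def[symmetric]
  proof (rule almost_all_colourings_rich[where g = rainbow and r = r, OF rainbow_mset I l m k0
        _ rainbow_improvable[OF m ml]])
    show "atoms rainbow (r k) n b \<gamma> = {}"
      if "k \<in> {1..\<rho>}" "m < r k" "\<gamma> \<in> {1..n} \<rightarrow>\<^sub>E {1..l}" for k n \<gamma> b
      by (rule rainbow_atoms_empty[OF high[OF that(1,2)] that(3)])
  qed (simp_all add: strongly_colourable_structures_def strong_colouring_iff_rainbow)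
qed

end
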